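(* Let $A$ and $B$ be abelian groups and let $\ell\le k$ be natural numbers. There is an isomorphism of elliptic groups $$({}_1\mathbb{Z}/3^k\mathbb{Z}\times {}_0A)\coprod({}_1\mathbb{Z}/3^\ell\mathbb{Z}\times {}_0B)\cong {}_{(0,1,0,0)}(\mathbb{Z}/3^{k+1}\mathbb{Z}\oplus\mathbb{Z}/3^\ell\mathbb{Z}\oplus A\oplus B).$$ More precisely, put $P={}_{(0,1,0,0)}(\mathbb{Z}/3^{k+1}\mathbb{Z}\oplus\mathbb{Z}/3^\ell\mathbb{Z}\oplus A\oplus B)$. The maps $i:{}_1\mathbb{Z}/3^k\mathbb{Z}\times {}_0A\to P$, $i([n]_{3^k},a)=([1-3n]_{3^{k+1}},[n]_{3^\ell},a,0)$, and $j:{}_1\mathbb{Z}/3^\ell\mathbb{Z}\times {}_0B\to P$, $j([m]_{3^\ell},b)=(0,[m]_{3^\ell},0,b)$, are (well-defined) morphisms of elliptic groups forming a coproduct diagram of elliptic groups: for any elliptic group $E$ and any morphisms of elliptic groups $f:{}_1\mathbb{Z}/3^k\mathbb{Z}\times {}_0A\to E$ and $g:{}_1\mathbb{Z}/3^\ell\mathbb{Z}\times {}_0B\to E$, there exists a unique morphism of elliptic groups $h:P\to E$ such that $f=h\circ i$ and $g=h\circ j$.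
   Context: An elliptic group is a set $S$ (possibly empty) with a binary operation $\ast$ satisfying, for all $x,y,z,w\in S$: (EG1) $x\ast y=y\ast x$; (EG2) $x\ast(x\ast y)=y$; (EG3) $x\ast(y\ast(z\ast w))=w\ast(y\ast(z\ast x))$. A morphism of elliptic groups $f:S\to T$ is a map with $f(x\ast y)=f(x)\ast f(y)$ for all $x,y$; an isomorphism is a bijective morphism. For an (additive) abelian group $A$ and $a\in A$, ${}_aA$ denotes the elliptic group with underlying set $A$ and operation $x\ast_a y=a-x-y$; thus ${}_1\mathbb{Z}/n\mathbb{Z}$ means ${}_{[1]}(\mathbb{Z}/n\mathbb{Z})$. $[a]_n$ denotes the class of the integer $a$ in $\mathbb{Z}/n\mathbb{Z}$. $\times$ is the product of elliptic groups (componentwise operation), $\oplus$ the direct sum of abelian groups, and $\coprod$ the coproduct in the category of elliptic groups. *)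

theory Defs
  imports "HOL-Algebra.Elementary_Groups"
begin

record 'a elliptic = "'a partial_object" +
  emul :: "'a \<Rightarrow> 'a \<Rightarrow> 'a" (infixl \<open>\<star>\<index>\<close> 70)

text \<open>The carrier may be empty.\<close>

locale elliptic_group =
  fixes S (structure)
  assumes closed: "\<lbrakk>x \<in> carrier S; y \<in> carrier S\<rbrakk> \<Longrightarrow> x \<star> y \<in> carrier S"
    and EG1: "\<lbrakk>x \<in> carrier S; y \<in> carrier S\<rbrakk> \<Longrightarrow> x \<star> y = y \<star> x"
    and EG2: "\<lbrakk>x \<in> carrier S; y \<in> carrier S\<rbrakk> \<Longrightarrow> x \<star> (x \<star> y) = y"
    and EG3: "\<lbrakk>x \<in> carrier S; y \<in> carrier S; z \<in> carrier S; w \<in> carrier S\<rbrakk>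
      \<Longrightarrow> x \<star> (y \<star> (z \<star> w)) = w \<star> (y \<star> (z \<star> x))"

definition eg_hom :: "('a, 'm) elliptic_scheme \<Rightarrow> ('b, 'n) elliptic_scheme \<Rightarrow> ('a \<Rightarrow> 'b) set" where
  "eg_hom S T = {f \<in> carrier S \<rightarrow> carrier T.
     \<forall>x \<in> carrier S. \<forall>y \<in> carrier S. f (x \<star>\<^bsub>S\<^esub> y) = f x \<star>\<^bsub>T\<^esub> f y}"

definition eg_iso :: "('a, 'm) elliptic_scheme \<Rightarrow> ('b, 'n) elliptic_scheme \<Rightarrow> ('a \<Rightarrow> 'b) set" where
  "eg_iso S T = {f \<in> eg_hom S T. bij_betw f (carrier S) (carrier T)}"

definition eg_is_iso :: "('a, 'm) elliptic_scheme \<Rightarrow> ('b, 'n) elliptic_scheme \<Rightarrow> bool"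
    (infix \<open>\<cong>\<^sub>E\<close> 50) where
  "S \<cong>\<^sub>E T \<longleftrightarrow> eg_iso S T \<noteq> {}"

text \<open>For an abelian group written multiplicatively, as in HOL-Algebra, the operation
  \<open>a - x - y\<close> reads \<open>a \<otimes> inv x \<otimes> inv y\<close>.\<close>

definition eg_of_group :: "'a \<Rightarrow> ('a, 'm) monoid_scheme \<Rightarrow> 'a elliptic" where
  "eg_of_group a A = \<lparr>carrier = carrier A,
     emul = (\<lambda>x y. a \<otimes>\<^bsub>A\<^esub> inv\<^bsub>A\<^esub> x \<otimes>\<^bsub>A\<^esub> inv\<^bsub>A\<^esub> y)\<rparr>"

definition eg_prod :: "('a, 'm) elliptic_scheme \<Rightarrow> ('b, 'n) elliptic_scheme \<Rightarrow> ('a \<times> 'b) elliptic"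
    (infixr \<open>\<times>\<^sub>E\<close> 80) where
  "S \<times>\<^sub>E T = \<lparr>carrier = carrier S \<times> carrier T,
     emul = (\<lambda>(x, y) (x', y'). (x \<star>\<^bsub>S\<^esub> x', y \<star>\<^bsub>T\<^esub> y'))\<rparr>"

text \<open>The coproduct of two elliptic groups, constructed as in any variety of algebras: formal
  products of elements of both, modulo the congruence generated by the axioms and by the
  multiplication tables. Its universal property is \<open>eg_coprod_universal\<close> below.\<close>

datatype 'x eg_term = Gen 'x | Mul "'x eg_term" "'x eg_term"

inductive_set coprod_terms :: "('a, 'm) elliptic_scheme \<Rightarrow> ('b, 'n) elliptic_scheme \<Rightarrow> ('a + 'b) eg_term set"
  for X Y where
  inl: "x \<in> carrier X \<Longrightarrow> Gen (Inl x) \<in> coprod_terms X Y"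
| inr: "y \<in> carrier Y \<Longrightarrow> Gen (Inr y) \<in> coprod_terms X Y"
| mul: "\<lbrakk>s \<in> coprod_terms X Y; t \<in> coprod_terms X Y\<rbrakk> \<Longrightarrow> Mul s t \<in> coprod_terms X Y"

inductive_set coprod_rel :: "('a, 'm) elliptic_scheme \<Rightarrow> ('b, 'n) elliptic_scheme
    \<Rightarrow> (('a + 'b) eg_term \<times> ('a + 'b) eg_term) set"
  for X Y where
  refl: "t \<in> coprod_terms X Y \<Longrightarrow> (t, t) \<in> coprod_rel X Y"
| sym: "(s, t) \<in> coprod_rel X Y \<Longrightarrow> (t, s) \<in> coprod_rel X Y"
| trans: "\<lbrakk>(s, t) \<in> coprod_rel X Y; (t, u) \<in> coprod_rel X Y\<rbrakk> \<Longrightarrow> (s, u) \<in> coprod_rel X Y"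
| mul: "\<lbrakk>(s, s') \<in> coprod_rel X Y; (t, t') \<in> coprod_rel X Y\<rbrakk>
    \<Longrightarrow> (Mul s t, Mul s' t') \<in> coprod_rel X Y"
| inl: "\<lbrakk>x \<in> carrier X; x' \<in> carrier X\<rbrakk>
    \<Longrightarrow> (Mul (Gen (Inl x)) (Gen (Inl x')), Gen (Inl (x \<star>\<^bsub>X\<^esub> x'))) \<in> coprod_rel X Y"
| inr: "\<lbrakk>y \<in> carrier Y; y' \<in> carrier Y\<rbrakk>
    \<Longrightarrow> (Mul (Gen (Inr y)) (Gen (Inr y')), Gen (Inr (y \<star>\<^bsub>Y\<^esub> y'))) \<in> coprod_rel X Y"
| EG1: "\<lbrakk>s \<in> coprod_terms X Y; t \<in> coprod_terms X Y\<rbrakk> \<Longrightarrow> (Mul s t, Mul t s) \<in> coprod_rel X Y"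
| EG2: "\<lbrakk>s \<in> coprod_terms X Y; t \<in> coprod_terms X Y\<rbrakk> \<Longrightarrow> (Mul s (Mul s t), t) \<in> coprod_rel X Y"
| EG3: "\<lbrakk>s \<in> coprod_terms X Y; t \<in> coprod_terms X Y; u \<in> coprod_terms X Y; v \<in> coprod_terms X Y\<rbrakk>
    \<Longrightarrow> (Mul s (Mul t (Mul u v)), Mul v (Mul t (Mul u s))) \<in> coprod_rel X Y"

definition eg_coprod :: "('a, 'm) elliptic_scheme \<Rightarrow> ('b, 'n) elliptic_scheme \<Rightarrow> ('a + 'b) eg_term set elliptic"
    (infixr \<open>\<amalg>\<^sub>E\<close> 65) where
  "X \<amalg>\<^sub>E Y = \<lparr>carrier = coprod_terms X Y // coprod_rel X Y,
     emul = (\<lambda>C D. \<Union>s\<in>C. \<Union>t\<in>D. coprod_rel X Y `` {Mul s t})\<rparr>"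

definition eg_inl :: "('a, 'm) elliptic_scheme \<Rightarrow> ('b, 'n) elliptic_scheme \<Rightarrow> 'a \<Rightarrow> ('a + 'b) eg_term set" where
  "eg_inl X Y x = coprod_rel X Y `` {Gen (Inl x)}"

definition eg_inr :: "('a, 'm) elliptic_scheme \<Rightarrow> ('b, 'n) elliptic_scheme \<Rightarrow> 'b \<Rightarrow> ('a + 'b) eg_term set" where
  "eg_inr X Y y = coprod_rel X Y `` {Gen (Inr y)}"

context
  fixes X :: "('a, 'm) elliptic_scheme" and Y :: "('b, 'n) elliptic_scheme"
  assumes X: "elliptic_group X" and Y: "elliptic_group Y"
begin

lemma coprod_rel_terms:
  "(s, t) \<in> coprod_rel X Y \<Longrightarrow> s \<in> coprod_terms X Y \<and> t \<in> coprod_terms X Y"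
  by (induction rule: coprod_rel.induct)
    (auto intro!: coprod_terms.intros elliptic_group.closed[OF X] elliptic_group.closed[OF Y])

lemma equiv_coprod_rel: "equiv (coprod_terms X Y) (coprod_rel X Y)"
  by (rule equivI)
    (auto intro!: refl_onI symI transI intro: coprod_rel.refl coprod_rel.sym coprod_rel.trans
      dest: coprod_rel_terms)

abbreviation (input) cls where "cls t \<equiv> coprod_rel X Y `` {t}"

lemma cls_eq_iff:
  "\<lbrakk>s \<in> coprod_terms X Y; t \<in> coprod_terms X Y\<rbrakk> \<Longrightarrow> cls s = cls t \<longleftrightarrow> (s, t) \<in> coprod_rel X Y"
  by (rule eq_equiv_class_iff[OF equiv_coprod_rel])

lemma cls_closed: "t \<in> coprod_terms X Y \<Longrightarrow> cls t \<in> carrier (X \<amalg>\<^sub>E Y)"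
  by (simp add: eg_coprod_def quotientI)

lemma coprod_cases:
  assumes "C \<in> carrier (X \<amalg>\<^sub>E Y)"
  obtains t where "t \<in> coprod_terms X Y" "C = cls t"
  using assms by (auto simp: eg_coprod_def elim: quotientE)

lemma cls_mul:
  assumes "s \<in> coprod_terms X Y" "t \<in> coprod_terms X Y"
  shows "cls s \<star>\<^bsub>X \<amalg>\<^sub>E Y\<^esub> cls t = cls (Mul s t)"
proof -
  have "cls (Mul s' t') = cls (Mul s t)" if "s' \<in> cls s" "t' \<in> cls t" for s' t'
    using that assms coprod_rel_terms
    by (subst cls_eq_iff) (auto intro: coprod_rel.mul coprod_rel.sym coprod_terms.mul)
  moreover have "s \<in> cls s" "t \<in> cls t"
    using assms by (auto intro: coprod_rel.refl)
  ultimately have "(\<Union>s'\<in>cls s. \<Union>t'\<in>cls t. cls (Mul s' t')) = cls (Mul s t)"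
    by blast
  then show ?thesis
    by (simp add: eg_coprod_def)
qed

lemma elliptic_group_eg_coprod: "elliptic_group (X \<amalg>\<^sub>E Y)"
  by (rule elliptic_group.intro; (elim coprod_cases)?)
    (auto simp: cls_mul cls_eq_iff cls_closed coprod_terms.mul
      intro: coprod_rel.EG1 coprod_rel.EG2 coprod_rel.EG3)

lemma eg_inl_hom: "eg_inl X Y \<in> eg_hom X (X \<amalg>\<^sub>E Y)"
  by (auto simp: eg_hom_def eg_inl_def cls_mul cls_eq_iff coprod_terms.intros elliptic_group.closed[OF X]
      intro!: cls_closed intro: coprod_rel.inl coprod_rel.sym)

lemma eg_inr_hom: "eg_inr X Y \<in> eg_hom Y (X \<amalg>\<^sub>E Y)"
  by (auto simp: eg_hom_def eg_inr_def cls_mul cls_eq_iff coprod_terms.intros elliptic_group.closed[OF Y]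
      intro!: cls_closed intro: coprod_rel.inr coprod_rel.sym)

primrec term_ev :: "('e, 'o) elliptic_scheme \<Rightarrow> ('a \<Rightarrow> 'e) \<Rightarrow> ('b \<Rightarrow> 'e) \<Rightarrow> ('a + 'b) eg_term \<Rightarrow> 'e" where
  "term_ev E f g (Gen z) = case_sum f g z"
| "term_ev E f g (Mul s t) = term_ev E f g s \<star>\<^bsub>E\<^esub> term_ev E f g t"

theorem eg_coprod_universal:
  assumes E: "elliptic_group E" and f: "f \<in> eg_hom X E" and g: "g \<in> eg_hom Y E"
  shows "\<exists>!h. h \<in> extensional (carrier (X \<amalg>\<^sub>E Y)) \<and> h \<in> eg_hom (X \<amalg>\<^sub>E Y) E \<and>
    (\<forall>x \<in> carrier X. f x = h (eg_inl X Y x)) \<and> (\<forall>y \<in> carrier Y. g y = h (eg_inr X Y y))"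
proof -
  interpret E: elliptic_group E by (rule E)
  let ?ev = "term_ev E f g"
  have ev_closed: "?ev t \<in> carrier E" if "t \<in> coprod_terms X Y" for t
    using that f g by induction (auto simp: eg_hom_def E.closed)
  have ev_rel: "?ev s = ?ev t" if "(s, t) \<in> coprod_rel X Y" for s t
    using that
  proof induction
    case (inl x x') then show ?case using f by (simp add: eg_hom_def)
  next
    case (inr x x') then show ?case using g by (simp add: eg_hom_def)
  next
    case (EG1 s t) then show ?case by (simp add: ev_closed E.EG1)
  next
    case (EG2 s t) then show ?case by (simp add: ev_closed E.EG2)
  next
    case (EG3 s t u v) then show ?case by (simp add: ev_closed E.EG3[of "?ev s" _ _ "?ev v"])
  qed simp_all
  define h where "h = restrict (\<lambda>C. ?ev (SOME t. t \<in> C)) (carrier (X \<amalg>\<^sub>E Y))"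
  have h_cls: "h (cls t) = ?ev t" if t: "t \<in> coprod_terms X Y" for t
  proof -
    have "t \<in> cls t" using t by (auto intro: coprod_rel.refl)
    then have "(SOME u. u \<in> cls t) \<in> cls t" by (rule someI)
    then have "?ev t = ?ev (SOME u. u \<in> cls t)" by (intro ev_rel) simp
    then show ?thesis by (simp add: h_def cls_closed t)
  qed
  have hom: "h \<in> eg_hom (X \<amalg>\<^sub>E Y) E"
    unfolding eg_hom_def
    by (auto elim!: coprod_cases simp: cls_mul h_cls ev_closed coprod_terms.mul)
  show ?thesis
  proof (rule ex1I[of _ h], intro conjI ballI)
    show "h \<in> extensional (carrier (X \<amalg>\<^sub>E Y))" by (simp add: h_def)
  next
    show "f x = h (eg_inl X Y x)" if "x \<in> carrier X" for x
      using that by (simp add: eg_inl_def h_cls coprod_terms.inl)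
  next
    show "g y = h (eg_inr X Y y)" if "y \<in> carrier Y" for y
      using that by (simp add: eg_inr_def h_cls coprod_terms.inr)
  next
    fix h'
    assume h': "h' \<in> extensional (carrier (X \<amalg>\<^sub>E Y)) \<and> h' \<in> eg_hom (X \<amalg>\<^sub>E Y) E \<and>
      (\<forall>x \<in> carrier X. f x = h' (eg_inl X Y x)) \<and> (\<forall>y \<in> carrier Y. g y = h' (eg_inr X Y y))"
    have "h' (cls t) = ?ev t" if "t \<in> coprod_terms X Y" for t
      using that
    proof induction
      case (mul s t)
      then have "h' (cls s \<star>\<^bsub>X \<amalg>\<^sub>E Y\<^esub> cls t) = h' (cls s) \<star>\<^bsub>E\<^esub> h' (cls t)"
        using h' cls_closed by (simp add: eg_hom_def)
      with mul show ?case by (simp add: cls_mul)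
    qed (use h' in \<open>auto simp: eg_inl_def eg_inr_def\<close>)
    then have "h' C = h C" if "C \<in> carrier (X \<amalg>\<^sub>E Y)" for C
      using that by (auto elim!: coprod_cases simp: h_cls)
    then show "h' = h"
      using h' by (intro extensionalityI[where A = "carrier (X \<amalg>\<^sub>E Y)"]) (auto simp: h_def)
  qed (rule hom)
qed

end

text \<open>The library's \<open>integer_mod_group m\<close> represents the class of \<open>n\<close> by \<open>n mod int m\<close>; it is
  trivial for \<open>m = 1\<close>, where the class of \<open>1\<close> is \<open>0\<close>.\<close>

definition rescls :: "nat \<Rightarrow> int \<Rightarrow> int" where
  "rescls m n = n mod int m"

definition cyc_eg :: "nat \<Rightarrow> ('a, 'm) monoid_scheme \<Rightarrow> (int \<times> 'a) elliptic" where
  "cyc_eg k A =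
     eg_of_group (rescls (3 ^ k) 1) (integer_mod_group (3 ^ k)) \<times>\<^sub>E eg_of_group \<one>\<^bsub>A\<^esub> A"

definition P_eg :: "nat \<Rightarrow> nat \<Rightarrow> ('a, 'm) monoid_scheme \<Rightarrow> ('b, 'n) monoid_scheme
    \<Rightarrow> (int \<times> int \<times> 'a \<times> 'b) elliptic" where
  "P_eg k l A B = eg_of_group (rescls (3 ^ (k + 1)) 0, rescls (3 ^ l) 1, \<one>\<^bsub>A\<^esub>, \<one>\<^bsub>B\<^esub>)
     (integer_mod_group (3 ^ (k + 1)) \<times>\<times> integer_mod_group (3 ^ l) \<times>\<times> A \<times>\<times> B)"

text \<open>The two maps, given on the standard representatives of residue classes.\<close>

definition i_map :: "nat \<Rightarrow> nat \<Rightarrow> ('b, 'n) monoid_scheme \<Rightarrow> int \<times> 'a \<Rightarrow> int \<times> int \<times> 'a \<times> 'b" where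
  "i_map k l B = (\<lambda>(n, a). (rescls (3 ^ (k + 1)) (1 - 3 * n), rescls (3 ^ l) n, a, \<one>\<^bsub>B\<^esub>))"

definition j_map :: "nat \<Rightarrow> nat \<Rightarrow> ('a, 'm) monoid_scheme \<Rightarrow> int \<times> 'b \<Rightarrow> int \<times> int \<times> 'a \<times> 'b" where
  "j_map k l A = (\<lambda>(m, b). (rescls (3 ^ (k + 1)) 0, rescls (3 ^ l) m, \<one>\<^bsub>A\<^esub>, b))"

end

theory Submission
  imports Defs
begin

text \<open>A point \<open>e\<close> of an elliptic group \<open>S\<close> makes it an abelian group with
  \<open>x + y = e \<star> (x \<star> y)\<close>, zero \<open>e\<close>, and \<open>x \<star> y = c - x - y\<close> for \<open>c = e \<star> e\<close>; morphisms become
  affine maps \<open>f = f 0 + \<phi>\<close> with \<open>\<phi>\<close> additive. Pointing the target of \<open>f\<close> and \<open>g\<close> at \<open>g 0\<close> makes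
  \<open>g\<close> additive with \<open>g [1] = c\<close>, while \<open>f ([n], a) = u + n (c - 3u) + \<alpha> a\<close> with \<open>u = f 0\<close>. So a
  morphism \<open>h\<close> on \<open>P\<close> has to be \<open>h ([x], [y], a, b) = x u + y c + \<alpha> a + \<beta> b\<close>. The relation
  \<open>3\<^sup>l c = 0\<close> comes from \<open>g [3\<^sup>l] = g 0\<close>, and \<open>3\<^sup>k (c - 3u) = 0\<close> from \<open>f ([3\<^sup>k], 0) = f 0\<close>; together
  with \<open>l \<le> k\<close> they give \<open>3\<^sup>k\<^sup>+\<^sup>1 u = 0\<close>, so \<open>h\<close> is well defined.\<close>

section \<open>Elliptic groups as abelian groups\<close>

text \<open>Only the values of the operation on the carrier are prescribed. So
  \<open>cyc_eg\<close>, which is built as a product, \<open>P_eg\<close>, and an arbitrary elliptic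
  group with a chosen point all fit.\<close>

locale eg_model = comm_group G for G :: "('a, 'g) monoid_scheme" (structure) +
  fixes c :: 'a and S :: "('a, 's) elliptic_scheme"
  assumes const_closed: "c \<in> carrier G"
    and carrier_eq: "carrier S = carrier G"
    and emul_eq: "\<lbrakk>x \<in> carrier G; y \<in> carrier G\<rbrakk> \<Longrightarrow> x \<star>\<^bsub>S\<^esub> y = c \<otimes> inv x \<otimes> inv y"
begin

lemma elliptic_group_model: "elliptic_group S"
proof
  fix x y
  assume xy: "x \<in> carrier S" "y \<in> carrier S"
  then show "x \<star>\<^bsub>S\<^esub> y \<in> carrier S" "x \<star>\<^bsub>S\<^esub> y = y \<star>\<^bsub>S\<^esub> x"
    by (simp_all add: carrier_eq emul_eq const_closed m_ac)
  \<comment> \<open>The element c - x is kept as one block, which then cancels against its own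
    inverse in (c - x) - ((c - x) - y).\<close>
  show "x \<star>\<^bsub>S\<^esub> (x \<star>\<^bsub>S\<^esub> y) = y"
    using xy const_closed m_assoc[of "c \<otimes> inv x" "inv (c \<otimes> inv x)" y]
    by (simp add: carrier_eq emul_eq inv_mult[of "c \<otimes> inv x" "inv y"] del: inv_mult_group)
next
  fix x y z w
  assume "x \<in> carrier S" "y \<in> carrier S" "z \<in> carrier S" "w \<in> carrier S"
  then show "x \<star>\<^bsub>S\<^esub> (y \<star>\<^bsub>S\<^esub> (z \<star>\<^bsub>S\<^esub> w)) = w \<star>\<^bsub>S\<^esub> (y \<star>\<^bsub>S\<^esub> (z \<star>\<^bsub>S\<^esub> x))"
    by (simp add: carrier_eq emul_eq const_closed inv_mult m_ac)
qed

end

lemma eg_homD: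
  assumes "f \<in> eg_hom S T"
  shows "x \<in> carrier S \<Longrightarrow> f x \<in> carrier T"
    and "\<lbrakk>x \<in> carrier S; y \<in> carrier S\<rbrakk> \<Longrightarrow> f (x \<star>\<^bsub>S\<^esub> y) = f x \<star>\<^bsub>T\<^esub> f y"
  using assms by (auto simp: eg_hom_def)

lemma eg_homI:
  assumes "\<And>x. x \<in> carrier S \<Longrightarrow> f x \<in> carrier T"
    and "\<And>x y. \<lbrakk>x \<in> carrier S; y \<in> carrier S\<rbrakk> \<Longrightarrow> f (x \<star>\<^bsub>S\<^esub> y) = f x \<star>\<^bsub>T\<^esub> f y"
  shows "f \<in> eg_hom S T"
  using assms by (auto simp: eg_hom_def)

lemma eg_hom_comp:
  assumes "f \<in> eg_hom S T" "g \<in> eg_hom T U"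
  shows "g \<circ> f \<in> eg_hom S U"
  using assms by (auto intro!: eg_homI simp: eg_homD)

text \<open>Closure of \<open>S\<close> puts x \<star> y back into the carrier, where the
  restriction still agrees with \<open>f\<close>.\<close>

lemma eg_hom_restrict:
  assumes "elliptic_group S" "f \<in> eg_hom S T"
  shows "restrict f (carrier S) \<in> eg_hom S T"
  using assms(2) elliptic_group.closed[OF assms(1)] by (auto intro!: eg_homI simp: eg_homD)

section \<open>The abelian group at a point of an elliptic group\<close>

definition eg_pointed :: "('a, 's) elliptic_scheme \<Rightarrow> 'a \<Rightarrow> 'a monoid" where
  "eg_pointed S e = \<lparr>carrier = carrier S, mult = (\<lambda>x y. e \<star>\<^bsub>S\<^esub> (x \<star>\<^bsub>S\<^esub> y)), one = e\<rparr>"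

lemma carrier_eg_pointed [simp]: "carrier (eg_pointed S e) = carrier S"
  by (simp add: eg_pointed_def)

text \<open>EG2 makes \<open>e\<close> neutral, and commutativity is EG1. Associativity is EG3,
  which exchanges the outer elements of z \<star> (e \<star> (y \<star> x)). The inverse of x is (e
  \<star> e) \<star> x, since its product with x is e \<star> e by EG2.\<close>

lemma (in elliptic_group) eg_model_pointed:
  assumes e: "e \<in> carrier S"
  shows "eg_model (eg_pointed S e) (e \<star> e) S"
proof -
  let ?G = "eg_pointed S e"
  have inverse: "(e \<star> e \<star> x) \<otimes>\<^bsub>?G\<^esub> x = \<one>\<^bsub>?G\<^esub>" if "x \<in> carrier S" for x
  proof -
    have "(e \<star> e \<star> x) \<star> x = x \<star> (x \<star> (e \<star> e))"
      using that e EG1[of "e \<star> e \<star> x" x] EG1[of "e \<star> e" x] by (simp add: closed)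
    then show ?thesis
      using that e by (simp add: eg_pointed_def closed EG2)
  qed
  have G: "comm_group ?G"
  proof (rule comm_groupI)
    fix x y z
    assume "x \<in> carrier ?G" "y \<in> carrier ?G" "z \<in> carrier ?G"
    then have xyz: "x \<in> carrier S" "y \<in> carrier S" "z \<in> carrier S"
      by (simp_all add: eg_pointed_def)
    have "(e \<star> (x \<star> y)) \<star> z = z \<star> (e \<star> (y \<star> x))"
      using xyz e by (simp add: closed EG1)
    also have "\<dots> = x \<star> (e \<star> (y \<star> z))"
      using xyz e by (intro EG3)
    finally show "x \<otimes>\<^bsub>?G\<^esub> y \<otimes>\<^bsub>?G\<^esub> z = x \<otimes>\<^bsub>?G\<^esub> (y \<otimes>\<^bsub>?G\<^esub> z)"
      by (simp add: eg_pointed_def)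
  next
    fix x assume x: "x \<in> carrier ?G"
    then show "\<exists>y\<in>carrier ?G. y \<otimes>\<^bsub>?G\<^esub> x = \<one>\<^bsub>?G\<^esub>"
      using inverse[of x] e
      by (intro bexI[of _ "e \<star> e \<star> x"]) (simp_all add: eg_pointed_def closed)
  qed (use e in \<open>auto simp: eg_pointed_def closed EG2 intro: EG1 arg_cong\<close>)
  then interpret G: comm_group ?G .
  show ?thesis
  proof
    fix x y assume "x \<in> carrier ?G" "y \<in> carrier ?G"
    then have xy: "x \<in> carrier S" "y \<in> carrier S"
      by (simp_all add: eg_pointed_def)
    have "inv\<^bsub>?G\<^esub> (x \<otimes>\<^bsub>?G\<^esub> y) = e \<star> e \<star> (x \<otimes>\<^bsub>?G\<^esub> y)"
      using xy e inverse by (intro G.inv_equality) (simp_all add: eg_pointed_def closed)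
    \<comment> \<open>Unfolded, the left side is e \<star> ((e \<star> e) \<star> ((e \<star> e)
      \<star> w)) with w = e \<star> (x \<star> y), and EG2 applies twice.\<close>
    moreover have "(e \<star> e) \<otimes>\<^bsub>?G\<^esub> (e \<star> e \<star> (x \<otimes>\<^bsub>?G\<^esub> y)) = x \<star> y"
      using xy e by (simp add: eg_pointed_def closed EG2)
    ultimately have "x \<star> y = (e \<star> e) \<otimes>\<^bsub>?G\<^esub> inv\<^bsub>?G\<^esub> (x \<otimes>\<^bsub>?G\<^esub> y)"
      by simp
    then show "x \<star> y = e \<star> e \<otimes>\<^bsub>?G\<^esub> inv\<^bsub>?G\<^esub> x \<otimes>\<^bsub>?G\<^esub> inv\<^bsub>?G\<^esub> y"
      using xy G.inv_closed[of x] G.inv_closed[of y] by (simp add: G.inv_mult G.m_assoc e closed)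
  qed (use e in \<open>simp_all add: eg_pointed_def closed\<close>)
qed

section \<open>Morphisms as affine maps\<close>

locale eg_model_pair = S: eg_model G a S + T: eg_model H b T
  for G :: "('a, 'g) monoid_scheme" and a and S :: "('a, 's) elliptic_scheme"
    and H :: "('b, 'h) monoid_scheme" and b and T :: "('b, 't) elliptic_scheme"
begin

text \<open>Addition can be recovered from the operation and zero alone: x + y = (x \<star> y)
  \<star> 0. Applying \<open>f\<close> gives (f x \<star> f y) \<star> f 0, which is f x + f y - f 0
  in \<open>H\<close>.\<close>

lemma eg_hom_linear_part:
  assumes f: "f \<in> eg_hom S T"
  shows "(\<lambda>x. f x \<otimes>\<^bsub>H\<^esub> inv\<^bsub>H\<^esub> f \<one>\<^bsub>G\<^esub>) \<in> hom G H"
proof (rule homI)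
  fix x y assume xy: "x \<in> carrier G" "y \<in> carrier G"
  note eg_homD[OF f, unfolded S.carrier_eq T.carrier_eq, simp]
  have "(x \<star>\<^bsub>S\<^esub> y) \<star>\<^bsub>S\<^esub> \<one>\<^bsub>G\<^esub> = x \<otimes>\<^bsub>G\<^esub> y"
    using xy by (simp add: S.emul_eq S.const_closed S.inv_mult S.m_assoc[symmetric])
  moreover have "x \<star>\<^bsub>S\<^esub> y \<in> carrier G"
    using xy by (simp add: S.emul_eq S.const_closed)
  then have "f ((x \<star>\<^bsub>S\<^esub> y) \<star>\<^bsub>S\<^esub> \<one>\<^bsub>G\<^esub>) = (f x \<star>\<^bsub>T\<^esub> f y) \<star>\<^bsub>T\<^esub> f \<one>\<^bsub>G\<^esub>"
    using xy by simp
  moreover have "(f x \<star>\<^bsub>T\<^esub> f y) \<star>\<^bsub>T\<^esub> f \<one>\<^bsub>G\<^esub> = f x \<otimes>\<^bsub>H\<^esub> f y \<otimes>\<^bsub>H\<^esub> inv\<^bsub>H\<^esub> f \<one>\<^bsub>G\<^esub>"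
    using xy by (simp add: T.emul_eq T.const_closed T.inv_mult T.m_assoc[symmetric])
  ultimately have "f (x \<otimes>\<^bsub>G\<^esub> y) = f x \<otimes>\<^bsub>H\<^esub> f y \<otimes>\<^bsub>H\<^esub> inv\<^bsub>H\<^esub> f \<one>\<^bsub>G\<^esub>"
    by simp
  then show "f (x \<otimes>\<^bsub>G\<^esub> y) \<otimes>\<^bsub>H\<^esub> inv\<^bsub>H\<^esub> f \<one>\<^bsub>G\<^esub>
      = f x \<otimes>\<^bsub>H\<^esub> inv\<^bsub>H\<^esub> f \<one>\<^bsub>G\<^esub> \<otimes>\<^bsub>H\<^esub> (f y \<otimes>\<^bsub>H\<^esub> inv\<^bsub>H\<^esub> f \<one>\<^bsub>G\<^esub>)"
    using xy by (simp add: T.m_ac)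
qed (simp add: eg_homD[OF f, unfolded S.carrier_eq T.carrier_eq])

text \<open>The constant is a = 0 \<star> 0, so f a = b - 2 f 0; subtracting f 0 once more gives the
  factor 3.\<close>

lemma eg_hom_linear_part_const:
  assumes f: "f \<in> eg_hom S T"
  shows "f a \<otimes>\<^bsub>H\<^esub> inv\<^bsub>H\<^esub> f \<one>\<^bsub>G\<^esub> = b \<otimes>\<^bsub>H\<^esub> inv\<^bsub>H\<^esub> (f \<one>\<^bsub>G\<^esub> [^]\<^bsub>H\<^esub> (3::int))"
proof -
  have u: "f \<one>\<^bsub>G\<^esub> \<in> carrier H"
    using eg_homD(1)[OF f, unfolded S.carrier_eq T.carrier_eq] by simp
  have "f \<one>\<^bsub>G\<^esub> [^]\<^bsub>H\<^esub> (1 + (1 + 1) :: int) = f \<one>\<^bsub>G\<^esub> \<otimes>\<^bsub>H\<^esub> (f \<one>\<^bsub>G\<^esub> \<otimes>\<^bsub>H\<^esub> f \<one>\<^bsub>G\<^esub>)"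
    using u by (simp only: T.int_pow_mult T.int_pow_1)
  moreover have "f a = b \<otimes>\<^bsub>H\<^esub> inv\<^bsub>H\<^esub> f \<one>\<^bsub>G\<^esub> \<otimes>\<^bsub>H\<^esub> inv\<^bsub>H\<^esub> f \<one>\<^bsub>G\<^esub>"
    using eg_homD(2)[OF f, of "\<one>\<^bsub>G\<^esub>" "\<one>\<^bsub>G\<^esub>"] u
    by (simp add: S.emul_eq T.emul_eq S.carrier_eq S.const_closed)
  ultimately show ?thesis
    using u by (simp add: T.inv_mult T.m_assoc T.const_closed)
qed

lemma eg_hom_imp_hom:
  assumes f: "f \<in> eg_hom S T" and "f \<one>\<^bsub>G\<^esub> = \<one>\<^bsub>H\<^esub>"
  shows "f \<in> hom G H"
  using S.hom_eq[OF eg_hom_linear_part[OF f], of f] assms(2) eg_homD(1)[OF f]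
  by (simp add: S.carrier_eq T.carrier_eq)

lemma eg_hom_if_hom:
  assumes "h \<in> hom G H" "h a = b"
  shows "h \<in> eg_hom S T"
proof -
  interpret h: group_hom G H h
    using assms(1) by unfold_locales
  show ?thesis
    using assms(2)
    by (intro eg_homI) (simp_all add: S.carrier_eq T.carrier_eq S.emul_eq T.emul_eq S.const_closed)
qed

end

section \<open>Homomorphisms from cyclic groups and products\<close>

lemma (in group) int_pow_mod_eq:
  assumes x: "x \<in> carrier G" and "x [^] int N = \<one>"
  shows "x [^] (n mod int N) = x [^] n"
proof -
  have "x [^] n = x [^] (int N * (n div int N) + n mod int N)"
    by simp
  also have "\<dots> = (x [^] int N) [^] (n div int N) \<otimes> x [^] (n mod int N)"
    using x by (simp only: int_pow_mult int_pow_pow)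
  finally show ?thesis
    using assms by simp
qed

lemma (in group) int_pow_hom_integer_mod_group:
  assumes x: "x \<in> carrier G" and N: "x [^] int N = \<one>"
  shows "(\<lambda>n. x [^] n) \<in> hom (integer_mod_group N) G"
  using x by (intro homI) (simp_all add: int_pow_mod_eq[OF x N] int_pow_mult)

lemma rescls_closed [simp]: "0 < N \<Longrightarrow> rescls N n \<in> carrier (integer_mod_group N)"
  by (simp add: rescls_def carrier_integer_mod_group)

lemma rescls_mult [simp]: "rescls N m \<otimes>\<^bsub>integer_mod_group N\<^esub> rescls N n = rescls N (m + n)"
  by (simp add: rescls_def mod_add_eq)

lemma rescls_inv [simp]: "0 < N \<Longrightarrow> inv\<^bsub>integer_mod_group N\<^esub> rescls N n = rescls N (- n)"
  by (simp add: rescls_def carrier_integer_mod_group mod_minus_eq)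

text \<open>The class of 1 generates the cyclic group; this includes N = 1, where that class is
  0.\<close>

lemma hom_integer_mod_group_eq_int_pow:
  assumes H: "group H" and f: "f \<in> hom (integer_mod_group N) H" and N: "0 < N"
  shows "f (rescls N n) = f (rescls N 1) [^]\<^bsub>H\<^esub> n"
proof -
  have "rescls N 1 [^]\<^bsub>integer_mod_group N\<^esub> n = rescls N n"
    by (simp add: int_pow_integer_mod_group rescls_def mod_mult_right_eq)
  then show ?thesis
    using hom_int_pow[OF f rescls_closed[OF N] group_integer_mod_group H] by metis
qed

lemma DirProd_comm_group:
  assumes "comm_group G" "comm_group H"
  shows "comm_group (G \<times>\<times> H)"
proof -
  interpret G: comm_group G by fact
  interpret H: comm_group H by fact
  interpret group "G \<times>\<times> H"
    by (intro DirProd_group) unfold_locales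
  show ?thesis
    by (rule group_comm_groupI) (auto simp: G.m_comm H.m_comm)
qed

text \<open>Commutativity of \<open>G\<close> allows the values of \<open>p\<close> and
  \<open>q\<close> to be regrouped. This is the existence half of the direct sum being a coproduct;
  nested three times it builds the morphism out of \<open>P_group\<close>.\<close>

lemma (in comm_group) hom_DirProd_combine:
  assumes "p \<in> hom K G" "q \<in> hom L G"
  shows "(\<lambda>(x, y). p x \<otimes> q y) \<in> hom (K \<times>\<times> L) G"
  using assms by (intro homI) (auto simp: hom_in_carrier hom_mult m_ac)

section \<open>The elliptic groups of the coproduct diagram\<close>

lemma eg_model_cyc:
  assumes A: "comm_group A"
  shows "eg_model (integer_mod_group (3 ^ k) \<times>\<times> A) (rescls (3 ^ k) 1, \<one>\<^bsub>A\<^esub>) (cyc_eg k A)"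
proof -
  interpret A: comm_group A by fact
  interpret comm_group "integer_mod_group (3 ^ k) \<times>\<times> A"
    by (intro DirProd_comm_group) (simp_all add: A)
  show ?thesis
    by unfold_locales
      (auto simp: cyc_eg_def eg_prod_def eg_of_group_def inv_DirProd A.group_axioms)
qed

text \<open>Elements are named by integers that need not be reduced, so that formulas stated with
  \<open>rescls\<close> for every integer apply to them directly.\<close>

lemma cyc_carrierE:
  assumes "x \<in> carrier (cyc_eg m G)"
  obtains n a where "x = (rescls (3 ^ m) n, a)" "a \<in> carrier G"
  using assms
  by (cases x) (auto simp: cyc_eg_def eg_prod_def eg_of_group_def rescls_def carrier_integer_mod_group
    intro: mod_pos_pos_trivial[symmetric])

lemma cyc_carrierI [simp]: "a \<in> carrier G \<Longrightarrow> (rescls (3 ^ m) n, a) \<in> carrier (cyc_eg m G)"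
  by (simp add: cyc_eg_def eg_prod_def eg_of_group_def)

lemma cyc_emul_rescls:
  assumes "comm_group G" "a \<in> carrier G" "a' \<in> carrier G"
  shows "(rescls (3 ^ m) n, a) \<star>\<^bsub>cyc_eg m G\<^esub> (rescls (3 ^ m) n', a')
    = (rescls (3 ^ m) (1 - n - n'), inv\<^bsub>G\<^esub> a \<otimes>\<^bsub>G\<^esub> inv\<^bsub>G\<^esub> a')"
proof -
  interpret comm_group G by fact
  show ?thesis
    using assms by (simp add: cyc_eg_def eg_prod_def eg_of_group_def del: mult_integer_mod_group inv_integer_mod_group)
qed

definition P_group :: "nat \<Rightarrow> nat \<Rightarrow> ('a, 'm) monoid_scheme \<Rightarrow> ('b, 'n) monoid_scheme
    \<Rightarrow> (int \<times> int \<times> 'a \<times> 'b) monoid" where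
  "P_group k l A B = integer_mod_group (3 ^ (k + 1)) \<times>\<times> integer_mod_group (3 ^ l) \<times>\<times> A \<times>\<times> B"

lemma eg_model_P:
  assumes A: "comm_group A" and B: "comm_group B"
  shows "eg_model (P_group k l A B) (0, rescls (3 ^ l) 1, \<one>\<^bsub>A\<^esub>, \<one>\<^bsub>B\<^esub>) (P_eg k l A B)"
proof -
  interpret A: comm_group A by fact
  interpret B: comm_group B by fact
  interpret comm_group "P_group k l A B"
    unfolding P_group_def by (intro DirProd_comm_group) (simp_all add: A B)
  show ?thesis
    by unfold_locales (simp_all add: P_eg_def P_group_def eg_of_group_def, simp_all add: rescls_def)
qed

text \<open>The linear part of \<open>f\<close> is additive on a direct sum, so it is n times its
  value at ([1], 0) plus its restriction \<open>\<alpha>\<close> to \<open>A\<close>. By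
  \<open>eg_hom_linear_part_const\<close> the value at ([1], 0) is c - 3u, which is
  \<open>v\<close>. The lemma serves both morphisms out of the summands of the coproduct.\<close>

lemma cyc_eg_hom_form:
  fixes f :: "int \<times> 'a \<Rightarrow> 'e" and H (structure)
  assumes A: "comm_group A" and T: "eg_model H c T" and f: "f \<in> eg_hom (cyc_eg k A) T"
  defines "u \<equiv> f (0, \<one>\<^bsub>A\<^esub>)"
  defines "v \<equiv> c \<otimes> inv (u [^] (3::int))" and "\<alpha> \<equiv> \<lambda>a. f (0, a) \<otimes> inv u"
  shows "u \<in> carrier H" and "\<alpha> \<in> hom A H" and "v [^] int (3 ^ k) = \<one>"
    and "a \<in> carrier A \<Longrightarrow> f (rescls (3 ^ k) n, a) = u \<otimes> (v [^] n \<otimes> \<alpha> a)"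
proof -
  interpret A: comm_group A by fact
  let ?Z = "integer_mod_group (3 ^ k)"
  interpret eg_model_pair "?Z \<times>\<times> A" "(rescls (3 ^ k) 1, \<one>\<^bsub>A\<^esub>)" "cyc_eg k A" H c T
    using eg_model_cyc[OF A] T by (simp add: eg_model_pair_def)
  let ?\<phi> = "\<lambda>x. f x \<otimes> inv u"
  have \<phi>: "?\<phi> \<in> hom (?Z \<times>\<times> A) H"
    using eg_hom_linear_part[OF f] by (simp add: u_def)
  have f_closed: "f (x, a) \<in> carrier H" if "x \<in> carrier ?Z" "a \<in> carrier A" for x a
    using eg_homD(1)[OF f, of "(x, a)"] that by (simp add: S.carrier_eq T.carrier_eq)
  show u: "u \<in> carrier H"
    using f_closed by (simp add: u_def)
  have v: "?\<phi> (rescls (3 ^ k) 1, \<one>\<^bsub>A\<^esub>) = v"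
    using eg_hom_linear_part_const[OF f] by (simp add: u_def v_def)
  show \<alpha>: "\<alpha> \<in> hom A H"
    unfolding \<alpha>_def using hom_mult[OF \<phi>, of "(0, _)" "(0, _)"] f_closed u
    by (intro homI) simp_all
  have "(\<lambda>n. ?\<phi> (n, \<one>\<^bsub>A\<^esub>)) \<in> hom ?Z H"
    using hom_mult[OF \<phi>, of "(_, \<one>\<^bsub>A\<^esub>)" "(_, \<one>\<^bsub>A\<^esub>)"] f_closed u
    by (intro homI) simp_all
  from hom_integer_mod_group_eq_int_pow[OF T.group_axioms this]
  have pow: "?\<phi> (rescls (3 ^ k) n, \<one>\<^bsub>A\<^esub>) = v [^] n" for n
    by (simp add: v)
  \<comment> \<open>The class of 3^k is 0, where the linear part vanishes; by \<open>pow\<close> the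
    same value is 3^k times \<open>v\<close>.\<close>
  have "?\<phi> (rescls (3 ^ k) (int (3 ^ k)), \<one>\<^bsub>A\<^esub>) = \<one>"
    using u by (simp add: rescls_def) (simp add: u_def)
  then show "v [^] int (3 ^ k) = \<one>"
    by (simp only: pow)
  show "f (rescls (3 ^ k) n, a) = u \<otimes> (v [^] n \<otimes> \<alpha> a)" if a: "a \<in> carrier A"
  proof -
    have "?\<phi> (rescls (3 ^ k) n, a) = ?\<phi> (rescls (3 ^ k) n, \<one>\<^bsub>A\<^esub>) \<otimes> ?\<phi> (0, a)"
      using hom_mult[OF \<phi>, of "(rescls (3 ^ k) n, \<one>\<^bsub>A\<^esub>)" "(0, a)"] a
      by (simp add: rescls_def carrier_integer_mod_group)
    then have "f (rescls (3 ^ k) n, a) \<otimes> inv u = v [^] n \<otimes> \<alpha> a"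
      by (simp add: pow \<alpha>_def)
    moreover have "v [^] n \<otimes> \<alpha> a \<in> carrier H"
      using u T.const_closed a hom_in_carrier[OF \<alpha>] by (simp add: v_def)
    ultimately show ?thesis
      using u f_closed a T.inv_solve_right'[of "v [^] n \<otimes> \<alpha> a" "f (rescls (3 ^ k) n, a)" u] by (simp add: T.m_comm)
  qed
qed

section \<open>The maps i and j, and P as a coproduct\<close>

context
  fixes A :: "('a, 'm) monoid_scheme" and B :: "('b, 'n) monoid_scheme" and k l :: nat
  assumes A: "comm_group A" and B: "comm_group B" and lk: "l \<le> k"
begin

interpretation A: comm_group A by (rule A)
interpretation B: comm_group B by (rule B)
interpretation X: eg_model "integer_mod_group (3 ^ k) \<times>\<times> A" "(rescls (3 ^ k) 1, \<one>\<^bsub>A\<^esub>)" "cyc_eg k A"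
  by (rule eg_model_cyc[OF A])
interpretation Y: eg_model "integer_mod_group (3 ^ l) \<times>\<times> B" "(rescls (3 ^ l) 1, \<one>\<^bsub>B\<^esub>)" "cyc_eg l B"
  by (rule eg_model_cyc[OF B])
interpretation P: eg_model "P_group k l A B" "(0, rescls (3 ^ l) 1, \<one>\<^bsub>A\<^esub>, \<one>\<^bsub>B\<^esub>)" "P_eg k l A B"
  by (rule eg_model_P[OF A B])

text \<open>Changing n by a multiple of 3^k changes 3n by a multiple of 3^(k+1), which settles the
  first coordinate. The second needs 3^l to divide 3^k, hence \<open>l \<le> k\<close>.\<close>

lemma i_map_rescls:
  "i_map k l B (rescls (3 ^ k) n, a) = (rescls (3 ^ (k + 1)) (1 - 3 * n), rescls (3 ^ l) n, a, \<one>\<^bsub>B\<^esub>)"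
proof -
  have "(3::int) ^ k dvd n - n mod 3 ^ k"
    by (simp add: minus_mod_eq_mult_div)
  then have "3 * 3 ^ k dvd 3 * (n - n mod 3 ^ k)"
    by (intro mult_dvd_mono) simp_all
  then have "(3::int) ^ (k + 1) dvd 1 - 3 * (n mod 3 ^ k) - (1 - 3 * n)"
    by (simp add: algebra_simps)
  moreover have "(3::int) ^ l dvd 3 ^ k"
    using lk by (rule le_imp_power_dvd)
  ultimately show ?thesis
    by (simp add: i_map_def rescls_def mod_mod_cancel mod_eq_dvd_iff)
qed

lemma j_map_rescls:
  "j_map k l A (rescls (3 ^ l) n, b) = (rescls (3 ^ (k + 1)) 0, rescls (3 ^ l) n, \<one>\<^bsub>A\<^esub>, b)"
  by (simp add: j_map_def rescls_def)

lemma P_emul_rescls: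
  assumes "a \<in> carrier A" "a' \<in> carrier A" "b \<in> carrier B" "b' \<in> carrier B"
  shows "(rescls (3 ^ (k + 1)) x, rescls (3 ^ l) y, a, b)
      \<star>\<^bsub>P_eg k l A B\<^esub> (rescls (3 ^ (k + 1)) x', rescls (3 ^ l) y', a', b')
    = (rescls (3 ^ (k + 1)) (- x - x'), rescls (3 ^ l) (1 - y - y'),
       inv\<^bsub>A\<^esub> a \<otimes>\<^bsub>A\<^esub> inv\<^bsub>A\<^esub> a', inv\<^bsub>B\<^esub> b \<otimes>\<^bsub>B\<^esub> inv\<^bsub>B\<^esub> b')"
  using assms A.group_axioms B.group_axioms
  by (simp add: P_eg_def eg_of_group_def inv_DirProd DirProd_group
      del: mult_integer_mod_group inv_integer_mod_group power_Suc)

lemma P_carrierE: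
  assumes "p \<in> carrier (P_eg k l A B)"
  obtains x y a b where "p = (rescls (3 ^ (k + 1)) x, rescls (3 ^ l) y, a, b)"
    "a \<in> carrier A" "b \<in> carrier B"
  using assms
  by (cases p) (auto simp: P_eg_def eg_of_group_def rescls_def carrier_integer_mod_group
    intro: mod_pos_pos_trivial[symmetric])

lemma P_carrierI [simp]:
  "\<lbrakk>a \<in> carrier A; b \<in> carrier B\<rbrakk> \<Longrightarrow>
    (rescls (3 ^ (k + 1)) x, rescls (3 ^ l) y, a, b) \<in> carrier (P_eg k l A B)"
  by (simp add: P_eg_def eg_of_group_def del: power_Suc)

text \<open>In the first coordinate the constant of P is 0, and the identity behind the claim is -(1
  - 3n) - (1 - 3n') = 1 - 3(1 - n - n').\<close>

lemma i_map_hom: "i_map k l B \<in> eg_hom (cyc_eg k A) (P_eg k l A B)"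
  by (intro eg_homI; elim cyc_carrierE)
    (simp_all add: i_map_rescls cyc_emul_rescls[OF A] P_emul_rescls del: power_Suc One_nat_def)

lemma j_map_hom: "j_map k l A \<in> eg_hom (cyc_eg l B) (P_eg k l A B)"
  by (intro eg_homI; elim cyc_carrierE)
    (simp_all add: j_map_rescls cyc_emul_rescls[OF B] P_emul_rescls
      del: power_Suc One_nat_def)

lemma P_hom_exists:
  fixes E :: "('e, 'o) elliptic_scheme"
  assumes E: "elliptic_group E" and f: "f \<in> eg_hom (cyc_eg k A) E" and g: "g \<in> eg_hom (cyc_eg l B) E"
  obtains h where "h \<in> eg_hom (P_eg k l A B) E"
    "\<And>x. x \<in> carrier (cyc_eg k A) \<Longrightarrow> f x = h (i_map k l B x)"
    "\<And>y. y \<in> carrier (cyc_eg l B) \<Longrightarrow> g y = h (j_map k l A y)"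
proof -
  interpret E: elliptic_group E by fact
  define e where "e = g (0, \<one>\<^bsub>B\<^esub>)"
  have zero_one: "(0, \<one>\<^bsub>B\<^esub>) \<in> carrier (cyc_eg l B)"
    using cyc_carrierI[of "\<one>\<^bsub>B\<^esub>" B l 0] by (simp add: rescls_def)
  have e: "e \<in> carrier E"
    using eg_homD(1)[OF g zero_one] by (simp add: e_def)
  define H where "H = eg_pointed E e"
  define c where "c = e \<star>\<^bsub>E\<^esub> e"
  have EH: "eg_model H c E"
    using E.eg_model_pointed[OF e] by (simp add: H_def c_def)
  interpret eg_model_pair "P_group k l A B" "(0, rescls (3 ^ l) 1, \<one>\<^bsub>A\<^esub>, \<one>\<^bsub>B\<^esub>)" "P_eg k l A B" H c E
    by (intro eg_model_pair.intro EH P.eg_model_axioms)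
  have one: "g (0, \<one>\<^bsub>B\<^esub>) = \<one>\<^bsub>H\<^esub>"
    by (simp add: H_def eg_pointed_def e_def)
  define u where "u = f (0, \<one>\<^bsub>A\<^esub>)"
  define v where "v = c \<otimes>\<^bsub>H\<^esub> inv\<^bsub>H\<^esub> (u [^]\<^bsub>H\<^esub> (3::int))"
  define \<alpha> where "\<alpha> = (\<lambda>a. f (0, a) \<otimes>\<^bsub>H\<^esub> inv\<^bsub>H\<^esub> u)"
  \<comment> \<open>The trivial factor is what is left of subtracting g 0, which is now zero.
    Removing it would take g (0, b) in the carrier, which is not known under the lambda.\<close>
  define \<beta> where "\<beta> = (\<lambda>b. g (0, b) \<otimes>\<^bsub>H\<^esub> \<one>\<^bsub>H\<^esub>)"
  note F = cyc_eg_hom_form[OF A EH f, folded u_def, folded v_def \<alpha>_def]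
  have f_form: "f (rescls (3 ^ k) n, a) = u \<otimes>\<^bsub>H\<^esub> (v [^]\<^bsub>H\<^esub> n \<otimes>\<^bsub>H\<^esub> \<alpha> a)" if "a \<in> carrier A" for n a
    using F(4)[OF that] by (simp only: \<alpha>_def)
  note c = T.const_closed
  \<comment> \<open>For \<open>g\<close> the base value is zero, so the general c - 3u is just
    \<open>c\<close>.\<close>
  have \<beta>: "\<beta> \<in> hom B H" and c_order: "c [^]\<^bsub>H\<^esub> int (3 ^ l) = \<one>\<^bsub>H\<^esub>"
    using cyc_eg_hom_form(2,3)[OF B EH g] c by (simp_all add: one \<beta>_def)
  have g_form: "g (rescls (3 ^ l) n, b) = c [^]\<^bsub>H\<^esub> n \<otimes>\<^bsub>H\<^esub> \<beta> b" if "b \<in> carrier B" for n b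
    using cyc_eg_hom_form(4)[OF B EH g that, of n] c hom_in_carrier[OF \<beta> that] by (simp add: one \<beta>_def)
  have u_order: "u [^]\<^bsub>H\<^esub> int (3 ^ (k + 1)) = \<one>\<^bsub>H\<^esub>"
  proof -
    have "c [^]\<^bsub>H\<^esub> int (3 ^ k) = (c [^]\<^bsub>H\<^esub> int (3 ^ l)) [^]\<^bsub>H\<^esub> int (3 ^ (k - l))"
      using c lk by (simp only: T.int_pow_pow flip: of_nat_mult power_add) simp
    then have "c [^]\<^bsub>H\<^esub> int (3 ^ k) = \<one>\<^bsub>H\<^esub>"
      by (simp only: c_order T.int_pow_one)
    then have "inv\<^bsub>H\<^esub> (u [^]\<^bsub>H\<^esub> (3 * int (3 ^ k))) = \<one>\<^bsub>H\<^esub>"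
      using F(1,3) c by (simp add: v_def T.int_pow_distrib T.int_pow_inv T.int_pow_pow)
    then show ?thesis
      using F(1) by (simp add: T.inv_eq_1_iff)
  qed
  define h where "h = (\<lambda>(x :: int, y :: int, a, b). u [^]\<^bsub>H\<^esub> x \<otimes>\<^bsub>H\<^esub> (c [^]\<^bsub>H\<^esub> y \<otimes>\<^bsub>H\<^esub> (\<alpha> a \<otimes>\<^bsub>H\<^esub> \<beta> b)))"

  \<comment> \<open>The order relations of \<open>u\<close> and \<open>c\<close> permit exponents
    that are not reduced.\<close>
  have h_rescls: "h (rescls (3 ^ (k + 1)) x, rescls (3 ^ l) y, a, b)
      = u [^]\<^bsub>H\<^esub> x \<otimes>\<^bsub>H\<^esub> (c [^]\<^bsub>H\<^esub> y \<otimes>\<^bsub>H\<^esub> (\<alpha> a \<otimes>\<^bsub>H\<^esub> \<beta> b))" for x y a b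
    using T.int_pow_mod_eq[OF F(1) u_order] T.int_pow_mod_eq[OF c c_order]
    by (simp add: h_def rescls_def)
  have \<alpha>1: "\<alpha> \<one>\<^bsub>A\<^esub> = \<one>\<^bsub>H\<^esub>" and \<beta>1: "\<beta> \<one>\<^bsub>B\<^esub> = \<one>\<^bsub>H\<^esub>"
    using hom_one[OF F(2) A.group_axioms T.group_axioms] hom_one[OF \<beta> B.group_axioms T.group_axioms]
    by auto
  note closed = F(1) c hom_in_carrier[OF F(2)] hom_in_carrier[OF \<beta>]
  have "h \<in> hom (P_group k l A B) H"
    unfolding P_group_def h_def
    using T.hom_DirProd_combine[OF T.int_pow_hom_integer_mod_group[OF F(1) u_order]
        T.hom_DirProd_combine[OF T.int_pow_hom_integer_mod_group[OF c c_order]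
          T.hom_DirProd_combine[OF F(2) \<beta>]]]
    by (simp only: case_prod_unfold)
  \<comment> \<open>An additive map is a morphism once it sends the constant of P to the constant
    \<open>c\<close> of E; this forces the weight \<open>c\<close> on the second coordinate.\<close>
  moreover have "h (0, rescls (3 ^ l) 1, \<one>\<^bsub>A\<^esub>, \<one>\<^bsub>B\<^esub>) = c"
    using h_rescls[of 0 1 "\<one>\<^bsub>A\<^esub>" "\<one>\<^bsub>B\<^esub>"] closed by (simp add: rescls_def \<alpha>1 \<beta>1)
  ultimately have "h \<in> eg_hom (P_eg k l A B) E"
    by (rule eg_hom_if_hom)
  moreover have "f x = h (i_map k l B x)" if x: "x \<in> carrier (cyc_eg k A)" for x
    using x
  proof (rule cyc_carrierE)
    fix n a assume xa: "x = (rescls (3 ^ k) n, a)" "a \<in> carrier A"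
    \<comment> \<open>The identity used is u + n(c - 3u) = (1 - 3n)u + nc, whose coefficients 1 - 3n
      and n are the first two coordinates of \<open>i_map\<close>.\<close>
    have "v [^]\<^bsub>H\<^esub> n = c [^]\<^bsub>H\<^esub> n \<otimes>\<^bsub>H\<^esub> inv\<^bsub>H\<^esub> (u [^]\<^bsub>H\<^esub> (3 * n))"
      using closed by (simp add: v_def T.int_pow_distrib T.int_pow_inv T.int_pow_pow)
    moreover have "u [^]\<^bsub>H\<^esub> (1 - 3 * n) = u \<otimes>\<^bsub>H\<^esub> inv\<^bsub>H\<^esub> (u [^]\<^bsub>H\<^esub> (3 * n))"
      using closed by (simp add: T.int_pow_diff)
    ultimately show ?thesis
      unfolding xa(1) i_map_rescls h_rescls f_form[OF xa(2)]
      using xa(2) closed by (simp add: \<beta>1 T.m_ac)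
  qed
  moreover have "g y = h (j_map k l A y)" if y: "y \<in> carrier (cyc_eg l B)" for y
    using y
  proof (rule cyc_carrierE)
    fix n b assume yb: "y = (rescls (3 ^ l) n, b)" "b \<in> carrier B"
    show ?thesis
      unfolding yb(1) j_map_rescls h_rescls g_form[OF yb(2)]
      using yb(2) closed by (simp add: \<alpha>1)
  qed
  ultimately show ?thesis
    by (rule that)
qed

text \<open>The zero of P lies in the image of j, so \<open>h\<close> and \<open>h'\<close> agree
  there and are both additive once E is pointed at that common value. Then the images of i and j
  suffice, because ([x], [y], a, b) = x i(0, 0) + j([y], b) + (i(0, a) - i(0, 0)).\<close>

lemma P_hom_unique:
  fixes E :: "('e, 'o) elliptic_scheme"
  assumes E: "elliptic_group E"
    and h: "h \<in> eg_hom (P_eg k l A B) E" and h': "h' \<in> eg_hom (P_eg k l A B) E"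
    and i: "\<And>x. x \<in> carrier (cyc_eg k A) \<Longrightarrow> h (i_map k l B x) = h' (i_map k l B x)"
    and j: "\<And>y. y \<in> carrier (cyc_eg l B) \<Longrightarrow> h (j_map k l A y) = h' (j_map k l A y)"
    and p: "p \<in> carrier (P_eg k l A B)"
  shows "h p = h' p"
proof -
  interpret E: elliptic_group E by fact
  let ?Z = "integer_mod_group (3 ^ (k + 1))"
  let ?e = "h \<one>\<^bsub>P_group k l A B\<^esub>"
  have e: "?e \<in> carrier E"
    using eg_homD(1)[OF h] by (simp add: P.carrier_eq)
  define H where "H = eg_pointed E ?e"
  interpret eg_model_pair "P_group k l A B" "(0, rescls (3 ^ l) 1, \<one>\<^bsub>A\<^esub>, \<one>\<^bsub>B\<^esub>)" "P_eg k l A B"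
    H "?e \<star>\<^bsub>E\<^esub> ?e" E
    unfolding H_def by (intro eg_model_pair.intro E.eg_model_pointed e P.eg_model_axioms)
  have j0: "j_map k l A (rescls (3 ^ l) 0, \<one>\<^bsub>B\<^esub>) = \<one>\<^bsub>P_group k l A B\<^esub>"
    unfolding j_map_rescls by (simp add: P_group_def rescls_def)
  have one: "\<one>\<^bsub>H\<^esub> = ?e"
    by (simp add: H_def eg_pointed_def)
  have "h' \<one>\<^bsub>P_group k l A B\<^esub> = ?e"
    using j[of "(rescls (3 ^ l) 0, \<one>\<^bsub>B\<^esub>)"] by (simp add: j0)
  then have hom: "h \<in> hom (P_group k l A B) H" "h' \<in> hom (P_group k l A B) H"
    using eg_hom_imp_hom[OF h] eg_hom_imp_hom[OF h'] one by simp_all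
  have form: "r (rescls (3 ^ (k + 1)) x, rescls (3 ^ l) y, a, b) =
      r (i_map k l B (rescls (3 ^ k) 0, \<one>\<^bsub>A\<^esub>)) [^]\<^bsub>H\<^esub> x \<otimes>\<^bsub>H\<^esub> (r (j_map k l A (rescls (3 ^ l) y, b))
        \<otimes>\<^bsub>H\<^esub> (r (i_map k l B (rescls (3 ^ k) 0, a)) \<otimes>\<^bsub>H\<^esub> inv\<^bsub>H\<^esub> r (i_map k l B (rescls (3 ^ k) 0, \<one>\<^bsub>A\<^esub>))))"
    if r: "r \<in> hom (P_group k l A B) H" and ab: "a \<in> carrier A" "b \<in> carrier B" for r x y a b
  proof -
    interpret r: group_hom "P_group k l A B" H r
      using r by unfold_locales
    let ?q = "\<lambda>x. (x, 0, \<one>\<^bsub>A\<^esub>, \<one>\<^bsub>B\<^esub>)"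
    let ?i = "\<lambda>a. i_map k l B (rescls (3 ^ k) 0, a)" and ?j = "j_map k l A (rescls (3 ^ l) y, b)"
    have closed: "?q (rescls (3 ^ (k + 1)) x) \<in> carrier (P_group k l A B)"
      "?i a \<in> carrier (P_group k l A B)" "?i \<one>\<^bsub>A\<^esub> \<in> carrier (P_group k l A B)"
      "?j \<in> carrier (P_group k l A B)"
      unfolding i_map_rescls j_map_rescls using ab by (simp_all add: P_group_def del: power_Suc)
    \<comment> \<open>The element i(0, 0) = ([1], 0, 0, 0) generates the first summand, so
      additivity of \<open>r\<close> along \<open>?q\<close> determines it there.\<close>
    have "?q \<in> hom ?Z (P_group k l A B)"
      by (intro homI) (simp_all add: P_group_def)
    then have "(\<lambda>x. r (?q x)) \<in> hom ?Z H"
      using hom_compose[OF _ r, of ?q ?Z] by (simp add: o_def)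
    from hom_integer_mod_group_eq_int_pow[OF T.group_axioms this, of x]
    have "r (?q (rescls (3 ^ (k + 1)) x)) = r (?i \<one>\<^bsub>A\<^esub>) [^]\<^bsub>H\<^esub> x"
      unfolding i_map_rescls by (simp add: rescls_def)
    moreover have "r (?q (rescls (3 ^ (k + 1)) x) \<otimes>\<^bsub>P_group k l A B\<^esub> (?j \<otimes>\<^bsub>P_group k l A B\<^esub>
        (?i a \<otimes>\<^bsub>P_group k l A B\<^esub> inv\<^bsub>P_group k l A B\<^esub> ?i \<one>\<^bsub>A\<^esub>)))
      = r (?q (rescls (3 ^ (k + 1)) x)) \<otimes>\<^bsub>H\<^esub> (r ?j \<otimes>\<^bsub>H\<^esub> (r (?i a) \<otimes>\<^bsub>H\<^esub> inv\<^bsub>H\<^esub> r (?i \<one>\<^bsub>A\<^esub>)))"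
      using closed by simp
    moreover have "?q (rescls (3 ^ (k + 1)) x) \<otimes>\<^bsub>P_group k l A B\<^esub> (?j \<otimes>\<^bsub>P_group k l A B\<^esub>
        (?i a \<otimes>\<^bsub>P_group k l A B\<^esub> inv\<^bsub>P_group k l A B\<^esub> ?i \<one>\<^bsub>A\<^esub>))
      = (rescls (3 ^ (k + 1)) x, rescls (3 ^ l) y, a, b)"
      unfolding i_map_rescls j_map_rescls P_group_def
      using ab A.group_axioms B.group_axioms
      by (simp add: inv_DirProd DirProd_group del: mult_integer_mod_group inv_integer_mod_group power_Suc)
        (simp add: rescls_def)
    ultimately show ?thesis
      by (simp only:)
  qed
  from p show ?thesis
  proof (rule P_carrierE)
    fix x y a b assume "p = (rescls (3 ^ (k + 1)) x, rescls (3 ^ l) y, a, b)"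
      "a \<in> carrier A" "b \<in> carrier B"
    then show ?thesis
      by (simp only: form[OF hom(1)] form[OF hom(2)] i j cyc_carrierI A.one_closed)
  qed
qed

text \<open>Both objects have the same universal property: each receives a morphism from the other
  compatible with the injections, and uniqueness on either side makes the two composites identities.
  Here \<open>P_hom_exists\<close> is used with the constructed coproduct itself as target.\<close>

lemma coprod_iso_P: "cyc_eg k A \<amalg>\<^sub>E cyc_eg l B \<cong>\<^sub>E P_eg k l A B"
proof -
  let ?X = "cyc_eg k A" and ?Y = "cyc_eg l B" and ?P = "P_eg k l A B"
  let ?C = "?X \<amalg>\<^sub>E ?Y"
  let ?inl = "eg_inl ?X ?Y" and ?inr = "eg_inr ?X ?Y"
  note XY = X.elliptic_group_model Y.elliptic_group_model
  note C = elliptic_group_eg_coprod[OF XY]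
  note inl = eg_inl_hom[OF XY] and inr = eg_inr_hom[OF XY]
  from P_hom_exists[OF C inl inr] obtain h where h: "h \<in> eg_hom ?P ?C"
    and hi: "\<And>x. x \<in> carrier ?X \<Longrightarrow> ?inl x = h (i_map k l B x)"
    and hj: "\<And>y. y \<in> carrier ?Y \<Longrightarrow> ?inr y = h (j_map k l A y)"
    by blast
  from eg_coprod_universal[OF XY P.elliptic_group_model i_map_hom j_map_hom]
  obtain e where e: "e \<in> eg_hom ?C ?P"
    and ei: "\<And>x. x \<in> carrier ?X \<Longrightarrow> i_map k l B x = e (?inl x)"
    and ej: "\<And>y. y \<in> carrier ?Y \<Longrightarrow> j_map k l A y = e (?inr y)"
    by blast
  have eh: "(e \<circ> h) p = id p" if "p \<in> carrier ?P" for p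
    using P.elliptic_group_model eg_hom_comp[OF h e] _ _ _ that
  proof (rule P_hom_unique)
    show "id \<in> eg_hom ?P ?P"
      by (simp add: eg_hom_def P.elliptic_group_model elliptic_group.closed)
  qed (simp_all flip: hi hj ei ej)
  have he: "h (e z) = z" if z: "z \<in> carrier ?C" for z
  proof -
    let ?r = "\<lambda>t. restrict t (carrier ?C)"
    have id: "id \<in> eg_hom ?C ?C"
      by (simp add: eg_hom_def)
    \<comment> \<open>Uniqueness in \<open>eg_coprod_universal\<close> is among extensional maps, so
      the composite and the identity are compared after restriction to the carrier.\<close>
    have "?r (h \<circ> e) = ?r id"
    proof (rule Uniq_D[OF conjunct2[OF eg_coprod_universal[OF XY C inl inr, unfolded ex1_iff_ex_Uniq]]])
    qed (use eg_hom_restrict[OF C eg_hom_comp[OF e h]] eg_hom_restrict[OF C id]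
        eg_homD(1)[OF inl] eg_homD(1)[OF inr] in \<open>simp_all flip: ei ej hi hj\<close>)
    then have "?r (h \<circ> e) z = ?r id z"
      by (rule fun_cong)
    then show ?thesis
      using z by simp
  qed
  have "bij_betw e (carrier ?C) (carrier ?P)"
    by (rule bij_betw_byWitness[where f' = h]) (use he eh eg_homD(1)[OF e] eg_homD(1)[OF h] in auto)
  with e show ?thesis
    by (auto simp: eg_is_iso_def eg_iso_def)
qed

end

theorem proposition10p4:
  fixes A :: "('a, 'm) monoid_scheme" and B :: "('b, 'n) monoid_scheme" and k l :: nat
  assumes A: "comm_group A" and B: "comm_group B" and lk: "l \<le> k"
  shows "elliptic_group (cyc_eg k A) \<and> elliptic_group (cyc_eg l B) \<and> elliptic_group (P_eg k l A B)
    \<and> cyc_eg k A \<amalg>\<^sub>E cyc_eg l B \<cong>\<^sub>E P_eg k l A B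
    \<comment> \<open>well-definedness: the formulas hold for every integer representative\<close>
    \<and> (\<forall>n. \<forall>a \<in> carrier A. i_map k l B (rescls (3 ^ k) n, a)
           = (rescls (3 ^ (k + 1)) (1 - 3 * n), rescls (3 ^ l) n, a, \<one>\<^bsub>B\<^esub>))
    \<and> (\<forall>m. \<forall>b \<in> carrier B. j_map k l A (rescls (3 ^ l) m, b)
           = (rescls (3 ^ (k + 1)) 0, rescls (3 ^ l) m, \<one>\<^bsub>A\<^esub>, b))
    \<and> i_map k l B \<in> eg_hom (cyc_eg k A) (P_eg k l A B)
    \<and> j_map k l A \<in> eg_hom (cyc_eg l B) (P_eg k l A B)
    \<comment> \<open>extensionality turns equality on the carrier of P into equality of functions\<close>
    \<and> (\<forall>(E :: 'e elliptic) f g. elliptic_group E \<and> f \<in> eg_hom (cyc_eg k A) E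
           \<and> g \<in> eg_hom (cyc_eg l B) E \<longrightarrow>
         (\<exists>!h. h \<in> extensional (carrier (P_eg k l A B)) \<and> h \<in> eg_hom (P_eg k l A B) E
            \<and> (\<forall>x \<in> carrier (cyc_eg k A). f x = (h \<circ> i_map k l B) x)
            \<and> (\<forall>y \<in> carrier (cyc_eg l B). g y = (h \<circ> j_map k l A) y)))"
proof (intro conjI allI impI ballI)
  note XYP = eg_model.elliptic_group_model[OF eg_model_cyc[OF A, of k]]
    eg_model.elliptic_group_model[OF eg_model_cyc[OF B, of l]]
    eg_model.elliptic_group_model[OF eg_model_P[OF A B, of k l]]
  show "elliptic_group (cyc_eg k A)" "elliptic_group (cyc_eg l B)" "elliptic_group (P_eg k l A B)"
    by (fact XYP)+
  show "cyc_eg k A \<amalg>\<^sub>E cyc_eg l B \<cong>\<^sub>E P_eg k l A B"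
    by (rule coprod_iso_P[OF A B lk])
  show i: "i_map k l B \<in> eg_hom (cyc_eg k A) (P_eg k l A B)"
    by (rule i_map_hom[OF A B lk])
  show j: "j_map k l A \<in> eg_hom (cyc_eg l B) (P_eg k l A B)"
    by (rule j_map_hom[OF A B lk])
  fix E :: "'e elliptic" and f g
  assume "elliptic_group E \<and> f \<in> eg_hom (cyc_eg k A) E \<and> g \<in> eg_hom (cyc_eg l B) E"
  then have E: "elliptic_group E" and f: "f \<in> eg_hom (cyc_eg k A) E" and g: "g \<in> eg_hom (cyc_eg l B) E"
    by simp_all
  from P_hom_exists[OF A B lk E f g] obtain h where h: "h \<in> eg_hom (P_eg k l A B) E"
    and hf: "\<And>x. x \<in> carrier (cyc_eg k A) \<Longrightarrow> f x = h (i_map k l B x)"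
    and hg: "\<And>y. y \<in> carrier (cyc_eg l B) \<Longrightarrow> g y = h (j_map k l A y)"
    by blast
  show "\<exists>!h. h \<in> extensional (carrier (P_eg k l A B)) \<and> h \<in> eg_hom (P_eg k l A B) E
      \<and> (\<forall>x \<in> carrier (cyc_eg k A). f x = (h \<circ> i_map k l B) x)
      \<and> (\<forall>y \<in> carrier (cyc_eg l B). g y = (h \<circ> j_map k l A) y)"
  proof (rule ex_ex1I)
    show "\<exists>h. h \<in> extensional (carrier (P_eg k l A B)) \<and> h \<in> eg_hom (P_eg k l A B) E
        \<and> (\<forall>x \<in> carrier (cyc_eg k A). f x = (h \<circ> i_map k l B) x)
        \<and> (\<forall>y \<in> carrier (cyc_eg l B). g y = (h \<circ> j_map k l A) y)"
      \<comment> \<open>Restriction makes \<open>h\<close> extensional and leaves its values on the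
        images of i and j unchanged, since these lie in the carrier of P.\<close>
      using eg_hom_restrict[OF XYP(3) h] eg_homD(1)[OF i] eg_homD(1)[OF j]
      by (intro exI[of _ "restrict h (carrier (P_eg k l A B))"]) (simp add: hf hg)
  next
    fix h h'
    assume hh': "h \<in> extensional (carrier (P_eg k l A B)) \<and> h \<in> eg_hom (P_eg k l A B) E
        \<and> (\<forall>x \<in> carrier (cyc_eg k A). f x = (h \<circ> i_map k l B) x)
        \<and> (\<forall>y \<in> carrier (cyc_eg l B). g y = (h \<circ> j_map k l A) y)"
      "h' \<in> extensional (carrier (P_eg k l A B)) \<and> h' \<in> eg_hom (P_eg k l A B) E
        \<and> (\<forall>x \<in> carrier (cyc_eg k A). f x = (h' \<circ> i_map k l B) x)
        \<and> (\<forall>y \<in> carrier (cyc_eg l B). g y = (h' \<circ> j_map k l A) y)"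
    show "h = h'"
    proof (rule extensionalityI)
      show "h \<in> extensional (carrier (P_eg k l A B))" "h' \<in> extensional (carrier (P_eg k l A B))"
        using hh' by blast+
      show "h p = h' p" if "p \<in> carrier (P_eg k l A B)" for p
      proof (rule P_hom_unique[OF A B lk E _ _ _ _ that])
        show "h \<in> eg_hom (P_eg k l A B) E" "h' \<in> eg_hom (P_eg k l A B) E"
          using hh' by blast+
        show "h (i_map k l B x) = h' (i_map k l B x)" if "x \<in> carrier (cyc_eg k A)" for x
          using hh' that by (metis o_apply)
        show "h (j_map k l A y) = h' (j_map k l A y)" if "y \<in> carrier (cyc_eg l B)" for y
          using hh' that by (metis o_apply)
      qed
    qed
  qed
qed (simp_all add: i_map_rescls[OF A B lk] j_map_rescls[OF A B lk])

end
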